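(* Let $n\ge1$. Given a triple $(\mathcal{L}_1,\mathcal{L}_2,\mathcal{L}_3)$ of Lagrangian planes in $\mathbb{C}^n\oplus\mathbb{C}^n$, define a Hermitian form $\Omega$ on $\mathcal{L}_1\oplus\mathcal{L}_2\oplus\mathcal{L}_3$ by $$\Omega(u_1,u_2,u_3;v_1,v_2,v_3)=\omega(u_1,v_2)+\omega(u_2,v_3)+\omega(u_3,v_1)-\omega(u_2,v_1)-\omega(u_3,v_2)-\omega(u_1,v_3),$$ and define $$\iota(\mathcal{L}_1,\mathcal{L}_2,\mathcal{L}_3):=n_-(\Omega)-n+\dim(\mathcal{L}_1\cap\mathcal{L}_3).$$ Then $\iota$ takes values in $\{0,1,\dots,n\}$ and satisfies: (1) $\iota(\mathcal{G}_0,\mathcal{G}_A,\mathcal{G}_\infty)=n_-(A)$ for any $n\times n$ Hermitian matrix $A$; (2) $\iota(\mathsf{S}\mathcal{L}_1,\mathsf{S}\mathcal{L}_2,\mathsf{S}\mathcal{L}_3)=\iota(\mathcal{L}_1,\mathcal{L}_2,\mathcal{L}_3)$ for any symplectic transformation $\mathsf{S}$ of $\mathbb{C}^n\oplus\mathbb{C}^n$ and any Lagrangian planes $\mathcal{L}_1,\mathcal{L}_2,\mathcal{L}_3$; (3) $\iota(\mathcal{L}_1,\mathcal{L}_2,\mathcal{L}_3)-\iota(\mathcal{L}_1,\mathcal{L}_2,\mathcal{L}_4)+\iota(\mathcal{L}_1,\mathcal{L}_3,\mathcal{L}_4)-\iota(\mathcal{L}_2,\mathcal{L}_3,\mathcal{L}_4)=0$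 for any Lagrangian planes $\mathcal{L}_1,\mathcal{L}_2,\mathcal{L}_3,\mathcal{L}_4$.
   Context: $\mathbb{C}^n\oplus\mathbb{C}^n$ is equipped with the canonical (sesquilinear) Hermitian symplectic form $\omega((x_1,x_2),(y_1,y_2)) := \langle x_1,y_2\rangle_{\mathbb{C}^n} - \langle x_2,y_1\rangle_{\mathbb{C}^n}$. A subspace $\mathcal{L}$ is Lagrangian (a "Lagrangian plane") if it equals $\{v : \omega(u,v)=0 \text{ for all } u\in\mathcal{L}\}$. A symplectic transformation is a complex-linear bijection $\mathsf{S}$ with $\omega(\mathsf{S}u,\mathsf{S}v)=\omega(u,v)$ for all $u,v$. For an $n\times n$ Hermitian matrix $M$, $\mathcal{G}_M := \{(x,Mx): x\in\mathbb{C}^n\}$ is its graph, so $\mathcal{G}_0=\mathbb{C}^n\oplus0$; also $\mathcal{G}_\infty := 0\oplus\mathbb{C}^n$. $n_-$ denotes the number of negative eigenvalues of a Hermitian matrix, counted with multiplicity, or, for a Hermitian form, the maximal dimension of a subspace on which it is negative definite. *)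

theory Defs
  imports "HOL-Analysis.Analysis"
begin

type_synonym 'n cpair = "(complex ^ 'n) \<times> (complex ^ 'n)"
type_synonym 'n ctriple = "'n cpair \<times> 'n cpair \<times> 'n cpair"

text \<open>
  The product type only carries a real vector space structure by type class; the complex scalar
  multiplications on \<open>\<complex>\<^sup>n \<oplus> \<complex>\<^sup>n\<close> and on three copies of it are given explicitly, and all subspaces
  and dimensions below are complex ones.
\<close>

definition scale2 :: "complex \<Rightarrow> 'n cpair \<Rightarrow> 'n::finite cpair" where
  "scale2 c u = (c *s fst u, c *s snd u)"

definition scale3 :: "complex \<Rightarrow> 'n ctriple \<Rightarrow> 'n::finite ctriple" where
  "scale3 c u = (scale2 c (fst u), scale2 c (fst (snd u)), scale2 c (snd (snd u)))"

interpretation prod2: finite_dimensional_vector_space_prod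
  "(*s) :: complex \<Rightarrow> complex ^ 'n \<Rightarrow> complex ^ 'n::finite"
  "(*s) :: complex \<Rightarrow> complex ^ 'n \<Rightarrow> complex ^ 'n::finite" cart_basis cart_basis
  ..

lemma scale2_eq_prod: "scale2 = prod2.scale"
  by (intro ext) (simp add: scale2_def prod2.scale_def)

interpretation cpair: finite_dimensional_vector_space
  "scale2 :: complex \<Rightarrow> 'n cpair \<Rightarrow> 'n::finite cpair" prod2.Basis_pair
  unfolding scale2_eq_prod by (rule prod2.p.finite_dimensional_vector_space_axioms)

interpretation prod22: finite_dimensional_vector_space_prod
  "scale2 :: complex \<Rightarrow> 'n cpair \<Rightarrow> 'n::finite cpair"
  "scale2 :: complex \<Rightarrow> 'n cpair \<Rightarrow> 'n::finite cpair" prod2.Basis_pair prod2.Basis_pair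
  ..

interpretation prod222: finite_dimensional_vector_space_prod
  "scale2 :: complex \<Rightarrow> 'n cpair \<Rightarrow> 'n::finite cpair"
  "prod22.scale :: complex \<Rightarrow> 'n cpair \<times> 'n cpair \<Rightarrow> 'n cpair \<times> 'n::finite cpair"
  prod2.Basis_pair prod22.Basis_pair
  ..

lemma scale3_eq_prod: "scale3 = prod222.scale"
  by (intro ext) (simp add: scale3_def prod222.scale_def prod22.scale_def)

interpretation ctriple: finite_dimensional_vector_space
  "scale3 :: complex \<Rightarrow> 'n ctriple \<Rightarrow> 'n::finite ctriple" prod222.Basis_pair
  unfolding scale3_eq_prod by (rule prod222.p.finite_dimensional_vector_space_axioms)

definition cinner :: "complex ^ 'n \<Rightarrow> complex ^ 'n::finite \<Rightarrow> complex" where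
  "cinner x y = (\<Sum>i\<in>UNIV. x $ i * cnj (y $ i))"

definition sympl :: "'n cpair \<Rightarrow> 'n::finite cpair \<Rightarrow> complex" where
  "sympl u v = cinner (fst u) (snd v) - cinner (snd u) (fst v)"

definition lagrangian :: "'n::finite cpair set \<Rightarrow> bool" where
  "lagrangian L \<longleftrightarrow> cpair.subspace L \<and> L = {v. \<forall>u\<in>L. sympl u v = 0}"

definition symplectic :: "('n cpair \<Rightarrow> 'n::finite cpair) \<Rightarrow> bool" where
  "symplectic S \<longleftrightarrow> Vector_Spaces.linear scale2 scale2 S \<and> bij S \<and>
     (\<forall>u v. sympl (S u) (S v) = sympl u v)"

definition hermitian_matrix :: "complex ^ 'n ^ 'n::finite \<Rightarrow> bool" where
  "hermitian_matrix A \<longleftrightarrow> (\<forall>i j. A $ i $ j = cnj (A $ j $ i))"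

definition graph_plane :: "complex ^ 'n ^ 'n \<Rightarrow> 'n::finite cpair set" where
  "graph_plane M = {(x, M *v x) | x. True}"

definition infinity_plane :: "'n::finite cpair set" where
  "infinity_plane = {(0, y) | y. True}"

text \<open>
  Number of negative eigenvalues of a Hermitian matrix. Its eigenvalues are real and their
  algebraic and geometric multiplicities agree, so each one is counted with the complex dimension
  of its eigenspace.
\<close>

definition eigenspace :: "complex ^ 'n ^ 'n \<Rightarrow> real \<Rightarrow> (complex ^ 'n::finite) set" where
  "eigenspace A r = {x. A *v x = complex_of_real r *s x}"

definition n_minus_matrix :: "complex ^ 'n ^ 'n::finite \<Rightarrow> nat" where
  "n_minus_matrix A = (\<Sum>r | r < 0 \<and> (\<exists>x. x \<noteq> 0 \<and> x \<in> eigenspace A r). vec.dim (eigenspace A r))"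

text \<open>
  For a Hermitian form \<open>B\<close> the value \<open>B w w\<close> is real, so negativity is expressed through its
  real part.
\<close>

definition n_minus_form :: "'n ctriple set \<Rightarrow> ('n ctriple \<Rightarrow> 'n::finite ctriple \<Rightarrow> complex) \<Rightarrow> nat" where
  "n_minus_form V B = Max {ctriple.dim W | W. ctriple.subspace W \<and> W \<subseteq> V \<and>
     (\<forall>w\<in>W. w \<noteq> 0 \<longrightarrow> Re (B w w) < 0)}"

lemma n_minus_form_set_finite_nonempty:
  fixes V :: "'n::finite ctriple set"
    and B :: "'n ctriple \<Rightarrow> 'n ctriple \<Rightarrow> complex"
  assumes "ctriple.subspace V"
  defines "D \<equiv> {ctriple.dim W | W. ctriple.subspace W \<and> W \<subseteq> V \<and>
     (\<forall>w\<in>W. w \<noteq> 0 \<longrightarrow> Re (B w w) < 0)}"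
  shows "finite D" "D \<noteq> {}"
proof -
  have "D \<subseteq> {..ctriple.dim V}"
    unfolding D_def by (auto intro: ctriple.dim_subset)
  then show "finite D"
    by (rule finite_subset) simp
  have "ctriple.dim {0 :: 'n ctriple} \<in> D"
    unfolding D_def using ctriple.subspace_0[OF assms(1)] ctriple.subspace_single_0 by blast
  then show "D \<noteq> {}"
    by blast
qed

fun Omega :: "'n ctriple \<Rightarrow> 'n::finite ctriple \<Rightarrow> complex" where
  "Omega (u1, u2, u3) (v1, v2, v3) =
     sympl u1 v2 + sympl u2 v3 + sympl u3 v1 - sympl u2 v1 - sympl u3 v2 - sympl u1 v3"

lemma cinner_commute: "cnj (cinner y x) = cinner x y"
  by (simp add: cinner_def mult.commute)

lemma cinner_left: "cinner (x + y) z = cinner x z + cinner y z" "cinner (c *s x) z = c * cinner x z"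
  by (simp_all add: cinner_def sum.distrib sum_distrib_left algebra_simps)

lemma sympl_commute: "cnj (sympl v u) = - sympl u v"
  by (simp add: sympl_def cinner_commute)

lemma sympl_left: "sympl (u + v) w = sympl u w + sympl v w" "sympl (scale2 c u) w = c * sympl u w"
  by (simp_all add: sympl_def scale2_def cinner_left algebra_simps)

lemma Omega_hermitian:
  "Omega u v = cnj (Omega v u)"
  "Omega (u + u') v = Omega u v + Omega u' v"
  "Omega (scale3 c u) v = c * Omega u v"
  by (cases u rule: prod_cases3; cases u' rule: prod_cases3; cases v rule: prod_cases3;
      simp add: sympl_commute sympl_left scale3_def algebra_simps)+

definition iota :: "'n cpair set \<Rightarrow> 'n cpair set \<Rightarrow> 'n::finite cpair set \<Rightarrow> int" where
  "iota L1 L2 L3 =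
     int (n_minus_form (L1 \<times> L2 \<times> L3) Omega) - int CARD('n) + int (cpair.dim (L1 \<inter> L3))"

end

theory Submission
  imports Defs
begin

text \<open>
  Three graphs of Hermitian matrices admit coordinates in which \<open>\<Omega>\<close> is block diagonal with blocks
  \<open>A3 - A2\<close>, \<open>A1 - A3\<close>, \<open>A2 - A1\<close>. Together with \<open>n\<^sub>-(X) + n\<^sub>-(-X) + dim (ker X) = n\<close> this gives
  \<open>\<iota>(A1, A2, A3) = n\<^sub>-(A2 - A1) + n\<^sub>-(A3 - A2) - n\<^sub>-(A3 - A1)\<close>. So \<open>\<iota>\<close> is a coboundary on
  graphs, and its bounds express the subadditivity of \<open>n\<^sub>-\<close>. A Lagrangian plane meets \<open>{(x, t x)}\<close>
  nontrivially for at most \<open>n\<close> real numbers \<open>t\<close>, hence one symplectic map turns any finite number of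
  Lagrangian planes into graphs simultaneously.
\<close>

section \<open>Hermitian and real inner products on complex vectors\<close>

lemma cinner_right:
  "cinner z (x + y) = cinner z x + cinner z y"
  "cinner z (c *s x) = cnj c * cinner z x"
  by (simp_all add: cinner_def sum.distrib sum_distrib_left algebra_simps)

lemma cinner_minus: "cinner (- x) y = - cinner x y" "cinner x (- y) = - cinner x y"
  by (simp_all add: cinner_def sum_negf)

lemma cinner_diff:
  "cinner (x - y) z = cinner x z - cinner y z"
  "cinner z (x - y) = cinner z x - cinner z y"
  by (simp_all add: cinner_def sum_subtractf algebra_simps)

lemma cinner_zero [simp]: "cinner 0 y = 0" "cinner x 0 = 0"
  by (simp_all add: cinner_def)

lemma cinner_sum:
  "cinner (\<Sum>i\<in>I. f i) y = (\<Sum>i\<in>I. cinner (f i) y)"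
  "cinner y (\<Sum>i\<in>I. f i) = (\<Sum>i\<in>I. cinner y (f i))"
  by (induction I rule: infinite_finite_induct; simp add: cinner_left cinner_right)+

lemma Re_cinner: "Re (cinner x y) = x \<bullet> y"
  by (simp add: cinner_def inner_vec_def inner_complex_def)

lemma cinner_self_eq_0 [simp]: "cinner x x = 0 \<longleftrightarrow> x = 0"
  by (metis Re_cinner cinner_zero(1) inner_eq_zero_iff zero_complex.sel(1))

lemma cinner_self: "cinner x x = complex_of_real (x \<bullet> x)"
proof -
  have "Im (cinner x x) = 0"
    by (metis cinner_commute complex_is_Real_iff Reals_cnj_iff)
  then show ?thesis
    by (simp add: complex_eq_iff Re_cinner)
qed

lemma scaleR_vec_eq: "(r *\<^sub>R x :: complex ^ 'n) = complex_of_real r *s x"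
  by (simp only: vec_eq_iff vector_scaleR_component vector_smult_component) (simp add: scaleR_conv_of_real)

lemma subspace_if_vec_subspace:
  assumes "vec.subspace (V :: (complex ^ 'n::finite) set)"
  shows "subspace V"
  using assms by (auto simp: subspace_def vec.subspace_def scaleR_vec_eq)

text \<open>A complex subspace contains \<open>\<i> *s x\<close> along with \<open>x\<close>, and
  testing that vector recovers the imaginary part. Real orthogonality results thus become Hermitian
  ones.\<close>

lemma cinner_eq_0_if_inner:
  assumes V: "vec.subspace V" and "x \<in> V" and z: "\<And>x. x \<in> V \<Longrightarrow> x \<bullet> z = 0"
  shows "cinner x z = 0"
proof -
  have "Re (cinner x z) = 0" "Re (cinner (\<i> *s x) z) = 0"
    using assms by (simp_all add: Re_cinner vec.subspace_scale)
  then show ?thesis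
    by (simp add: cinner_left complex_eq_iff)
qed

text \<open>A proper subspace has a nonzero real normal vector, which is then a Hermitian normal
  vector as well. This gives completeness of the eigenspaces and, later, surjectivity of the first
  projection of a Lagrangian plane.\<close>

lemma vec_subspace_eq_UNIV_if_cinner:
  assumes V: "vec.subspace V" and z: "\<And>z. (\<And>x. x \<in> V \<Longrightarrow> cinner x z = 0) \<Longrightarrow> z = 0"
  shows "V = UNIV"
proof (rule ccontr)
  assume "V \<noteq> UNIV"
  moreover have sV: "span V = V"
    using subspace_if_vec_subspace[OF V] span_eq_iff by blast
  ultimately obtain a where a: "a \<noteq> 0" "\<And>x. x \<in> V \<Longrightarrow> a \<bullet> x = 0"
    using span_not_UNIV_orthogonal[of V] by metis
  have "cinner x a = 0" if "x \<in> V" for x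
    using cinner_eq_0_if_inner[OF V that] a(2) by (simp add: inner_commute)
  then show False
    using z a(1) by blast
qed

text \<open>Nonzero orthogonal vectors are distinct, and an orthogonal family in finite dimension is
  finite. It bounds the eigenvalues of a Hermitian matrix and the exceptional slopes of a Lagrangian
  plane alike.\<close>

lemma finite_if_pairwise_cinner:
  fixes f :: "'a \<Rightarrow> complex ^ 'n::finite"
  assumes "\<And>r. r \<in> R \<Longrightarrow> f r \<noteq> 0" and "\<And>r s. r \<in> R \<Longrightarrow> s \<in> R \<Longrightarrow> r \<noteq> s \<Longrightarrow> cinner (f r) (f s) = 0"
  shows "finite R"
proof -
  have "pairwise orthogonal (f ` R)"
    unfolding pairwise_def orthogonal_def using assms(2)
    by (metis Re_cinner image_iff zero_complex.sel(1))
  moreover have "inj_on f R"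
    by (rule inj_onI) (metis assms cinner_self_eq_0)
  ultimately show ?thesis
    using pairwise_orthogonal_imp_finite finite_imageD by blast
qed

subsection \<open>Spectral decomposition of Hermitian matrices\<close>

lemma hermitian_matrix_cinner:
  assumes "hermitian_matrix A"
  shows "cinner (A *v x) y = cinner x (A *v y)"
proof -
  have "cinner (A *v x) y = (\<Sum>i\<in>UNIV. \<Sum>j\<in>UNIV. A $ i $ j * x $ j * cnj (y $ i))"
    by (simp add: cinner_def matrix_vector_mult_def sum_distrib_right)
  also have "\<dots> = (\<Sum>j\<in>UNIV. \<Sum>i\<in>UNIV. A $ i $ j * x $ j * cnj (y $ i))"
    by (rule sum.swap)
  also have "\<dots> = (\<Sum>j\<in>UNIV. \<Sum>i\<in>UNIV. x $ j * cnj (A $ j $ i * y $ i))"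
    by (intro sum.cong refl) (metis (no_types, lifting) assms hermitian_matrix_def complex_cnj_mult mult.assoc mult.left_commute)
  also have "\<dots> = cinner x (A *v y)"
    by (simp add: cinner_def matrix_vector_mult_def sum_distrib_left)
  finally show ?thesis .
qed

lemma hermitian_matrix_diff:
  "hermitian_matrix A \<Longrightarrow> hermitian_matrix B \<Longrightarrow> hermitian_matrix (A - B)"
  unfolding hermitian_matrix_def vector_minus_component complex_cnj_diff by metis

lemma hermitian_matrix_minus: "hermitian_matrix A \<Longrightarrow> hermitian_matrix (- A)"
  unfolding hermitian_matrix_def vector_uminus_component complex_cnj_minus by metis

lemma vec_subspace_eigenspace: "vec.subspace (eigenspace A r)"
  by (auto simp: vec.subspace_def eigenspace_def matrix_vector_right_distrib vec.scale_right_distrib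
      vec.scale mult.commute)

lemma cinner_eigenspaces:
  assumes "hermitian_matrix A" and "x \<in> eigenspace A r" "y \<in> eigenspace A s" and "r \<noteq> s"
  shows "cinner x y = 0"
proof -
  have "complex_of_real r * cinner x y = complex_of_real s * cinner x y"
    using hermitian_matrix_cinner[OF assms(1), of x y] assms(2,3)
    by (simp add: eigenspace_def cinner_left cinner_right)
  then show ?thesis
    using \<open>r \<noteq> s\<close> by simp
qed

text \<open>The eigenvector is a maximiser of the Rayleigh quotient on the unit sphere of \<open>V\<close>.\<close>

lemma eigenvector_in_invariant_subspace:
  assumes A: "hermitian_matrix A" and V: "vec.subspace V"
    and inv: "\<And>x. x \<in> V \<Longrightarrow> A *v x \<in> V" and "V \<noteq> {0}"
  shows "\<exists>r x. x \<in> V \<and> x \<noteq> 0 \<and> x \<in> eigenspace A r"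
proof -
  define q where "q x = (A *v x) \<bullet> x" for x
  have sV: "subspace V"
    by (rule subspace_if_vec_subspace[OF V])
  have sym: "(A *v x) \<bullet> y = x \<bullet> (A *v y)" for x y
    using hermitian_matrix_cinner[OF A, of x y] by (metis Re_cinner)
  have linA: "linear ((*v) A)"
    by (rule linearI) (simp_all add: matrix_vector_right_distrib scaleR_vec_eq vec.scale)
  obtain v where v: "v \<in> V" "v \<noteq> 0"
    using \<open>V \<noteq> {0}\<close> vec.subspace_0[OF V] by blast
  have "compact (sphere 0 1 \<inter> V)"
    using closed_subspace[OF sV] by (simp add: compact_Int_closed)
  moreover have "v /\<^sub>R norm v \<in> sphere 0 1 \<inter> V"
    using v sV by (simp add: subspace_scale)
  moreover have "continuous_on (sphere 0 1 \<inter> V) q"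
    unfolding q_def using linear_continuous_on[of "(*v) A"] linA
    by (intro continuous_intros)
  ultimately obtain x where x: "x \<in> sphere 0 1 \<inter> V" and max: "\<And>y. y \<in> sphere 0 1 \<inter> V \<Longrightarrow> q y \<le> q x"
    using continuous_attains_sup[of "sphere 0 1 \<inter> V" q] by blast
  have q_scale: "q (c *\<^sub>R y) = c\<^sup>2 * q y" for c y
    by (simp add: q_def linear_cmul[OF linA] power2_eq_square)
  \<comment> \<open>Homogeneity of degree two carries the maximum from the unit sphere to all of
    \<open>V\<close>.\<close>
  have bound: "q y \<le> q x * (y \<bullet> y)" if "y \<in> V" for y
  proof (cases "y = 0")
    case False
    then have "q (y /\<^sub>R norm y) \<le> q x"
      using that sV by (intro max) (simp add: subspace_scale)
    then show ?thesis
      using False by (simp add: q_scale field_simps power2_norm_eq_inner[symmetric])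
  qed (simp add: q_def)
  have xx: "x \<in> V" "x \<bullet> x = 1"
    using x by (auto simp: norm_eq_1)
  have orth: "(A *v x - q x *\<^sub>R x) \<bullet> w = 0" if "w \<in> V" for w
  proof -
    define c where "c = (A *v x - q x *\<^sub>R x) \<bullet> w"
    define d where "d = q x * (w \<bullet> w) - q w"
    \<comment> \<open>This is \<open>bound\<close> at the perturbed vector
      \<open>x + t *\<^sub>R w\<close>: the constant terms cancel, the linear term must be dominated
      by the quadratic one for every real \<open>t\<close>, and so \<open>c\<close> must
      vanish.\<close>
    have ineq: "2 * t * c \<le> t\<^sup>2 * d" for t
    proof -
      have "x + t *\<^sub>R w \<in> V"
        using xx(1) that sV by (simp add: subspace_add subspace_scale)
      from bound[OF this] show ?thesis
        using sym[of w x] xx(2)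
        by (simp add: q_def c_def d_def linear_add[OF linA] linear_cmul[OF linA] inner_simps
            algebra_simps power2_eq_square inner_commute)
    qed
    have "c = 0"
    proof (rule ccontr)
      assume "c \<noteq> 0"
      have "d \<ge> 0"
        using ineq[of 1] ineq[of "-1"] by simp
      \<comment> \<open>A small multiple of \<open>c\<close> makes the linear term win; the summand
        1 keeps the denominator positive even if \<open>d = 0\<close>.\<close>
      have "2 * (c / (d + 1)) * c \<le> (c / (d + 1))\<^sup>2 * d"
        by (rule ineq)
      then have "2 * c\<^sup>2 * (d + 1) \<le> c\<^sup>2 * d"
        using \<open>d \<ge> 0\<close> by (simp add: power2_eq_square divide_simps split: if_splits)
      then have "c\<^sup>2 * (d + 2) \<le> 0"
        by (simp add: algebra_simps)
      then show False
        using \<open>d \<ge> 0\<close> \<open>c \<noteq> 0\<close> by (simp add: mult_le_0_iff)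
    qed
    then show ?thesis
      by (simp add: c_def)
  qed
  \<comment> \<open>By invariance the residual lies in \<open>V\<close>, so it is orthogonal to
    itself and vanishes.\<close>
  have "A *v x - q x *\<^sub>R x \<in> V"
    using xx inv sV by (simp add: subspace_diff subspace_scale)
  from orth[OF this] have "A *v x = complex_of_real (q x) *s x"
    by (simp add: scaleR_vec_eq)
  then show ?thesis
    using xx by (auto simp: eigenspace_def intro!: exI[of _ x])
qed

text \<open>Real numbers suffice: for Hermitian \<open>A\<close> their eigenspaces already span the
  whole space, by \<open>eigensum_eq_UNIV\<close>.\<close>

definition eigenvalues :: "complex ^ 'n ^ 'n::finite \<Rightarrow> real set" where
  "eigenvalues A = {r. \<exists>x. x \<noteq> 0 \<and> x \<in> eigenspace A r}"

lemma finite_eigenvalues: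
  assumes "hermitian_matrix A"
  shows "finite (eigenvalues A)"
proof -
  obtain f where "\<And>r. r \<in> eigenvalues A \<Longrightarrow> f r \<noteq> 0 \<and> f r \<in> eigenspace A r"
    using bchoice[of "eigenvalues A" "\<lambda>r x. x \<noteq> 0 \<and> x \<in> eigenspace A r"]
    unfolding eigenvalues_def by blast
  then show ?thesis
    by (intro finite_if_pairwise_cinner[of _ f]) (auto intro: cinner_eigenspaces[OF assms])
qed

text \<open>For finite \<open>R\<close> this is the internal sum of the eigenspaces. Choosing one
  component for each element of \<open>R\<close> makes the decomposition of a vector available
  directly and suits induction on \<open>R\<close>.\<close>

definition eigensum :: "complex ^ 'n ^ 'n \<Rightarrow> real set \<Rightarrow> (complex ^ 'n::finite) set" where
  "eigensum A R = {\<Sum>r\<in>R. f r | f. \<forall>r\<in>R. f r \<in> eigenspace A r}"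

lemma vec_subspace_eigensum: "vec.subspace (eigensum A R)"
  unfolding vec.subspace_def
proof (intro conjI ballI allI)
  show "0 \<in> eigensum A R"
    unfolding eigensum_def
    by (auto intro!: exI[of _ "\<lambda>_. 0"] vec.subspace_0[OF vec_subspace_eigenspace])
next
  fix x y assume "x \<in> eigensum A R" "y \<in> eigensum A R"
  then obtain f g where "x = (\<Sum>r\<in>R. f r)" "y = (\<Sum>r\<in>R. g r)"
    "\<forall>r\<in>R. f r \<in> eigenspace A r" "\<forall>r\<in>R. g r \<in> eigenspace A r"
    unfolding eigensum_def by blast
  then show "x + y \<in> eigensum A R"
    unfolding eigensum_def
    by (auto simp: sum.distrib intro!: exI[of _ "\<lambda>r. f r + g r"] vec.subspace_add[OF vec_subspace_eigenspace])
next
  fix c x assume "x \<in> eigensum A R"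
  then obtain f where "x = (\<Sum>r\<in>R. f r)" "\<forall>r\<in>R. f r \<in> eigenspace A r"
    unfolding eigensum_def by blast
  then show "c *s x \<in> eigensum A R"
    unfolding eigensum_def
    by (auto simp: vec.scale_sum_right intro!: exI[of _ "\<lambda>r. c *s f r"] vec.subspace_scale[OF vec_subspace_eigenspace])
qed

lemma eigenspace_subset_eigensum:
  assumes "finite R" "r \<in> R"
  shows "eigenspace A r \<subseteq> eigensum A R"
proof
  fix x assume "x \<in> eigenspace A r"
  then show "x \<in> eigensum A R"
    unfolding eigensum_def using assms vec.subspace_0[OF vec_subspace_eigenspace]
    by (auto intro!: exI[of _ "\<lambda>s. if s = r then x else 0"] simp: sum.delta)
qed

text \<open>This is the spectral theorem. The orthogonal complement of all eigenspaces is invariant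
  because \<open>A\<close> is self-adjoint; were it nonzero, it would contain an eigenvector, which
  would be orthogonal to itself.\<close>

lemma eigensum_eq_UNIV:
  assumes A: "hermitian_matrix A"
  shows "eigensum A (eigenvalues A) = UNIV"
proof (rule vec_subspace_eq_UNIV_if_cinner[OF vec_subspace_eigensum], rule ccontr)
  fix z
  assume z: "\<And>x. x \<in> eigensum A (eigenvalues A) \<Longrightarrow> cinner x z = 0" and "z \<noteq> 0"
  define V where "V = {y. \<forall>r x. x \<in> eigenspace A r \<longrightarrow> cinner x y = 0}"
  have V: "vec.subspace V"
    by (auto simp: vec.subspace_def V_def cinner_right)
  have "A *v y \<in> V" if "y \<in> V" for y
    unfolding V_def
  proof (intro CollectI allI impI)
    fix r x assume "x \<in> eigenspace A r"
    then show "cinner x (A *v y) = 0"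
      using that hermitian_matrix_cinner[OF A, of x y] by (force simp: V_def eigenspace_def cinner_left)
  qed
  moreover have "z \<in> V"
    unfolding V_def
  proof (intro CollectI allI impI)
    fix r x assume x: "x \<in> eigenspace A r"
    show "cinner x z = 0"
    proof (cases "x = 0")
      case False
      then have "r \<in> eigenvalues A"
        using x by (auto simp: eigenvalues_def)
      then show ?thesis
        using z eigenspace_subset_eigensum[OF finite_eigenvalues[OF A]] x by blast
    qed simp
  qed
  ultimately obtain r x where "x \<in> V" "x \<noteq> 0" "x \<in> eigenspace A r"
    using eigenvector_in_invariant_subspace[OF A V] \<open>z \<noteq> 0\<close> by blast
  then show False
    unfolding V_def using cinner_self_eq_0 by blast
qed

text \<open>Orthogonality of different eigenspaces makes the sum direct, so the dimension formula
  for sums applies with trivial intersection each time an eigenspace is added.\<close>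

lemma dim_eigensum:
  assumes A: "hermitian_matrix A" and "finite R"
  shows "vec.dim (eigensum A R) = (\<Sum>r\<in>R. vec.dim (eigenspace A r))"
  using \<open>finite R\<close>
proof induction
  case empty
  then show ?case
    by (simp add: eigensum_def)
next
  case (insert r R)
  have "eigensum A (insert r R) = {x + y |x y. x \<in> eigenspace A r \<and> y \<in> eigensum A R}" (is "?L = ?R")
  proof
    show "?L \<subseteq> ?R"
      using insert by (auto simp: eigensum_def)
    show "?R \<subseteq> ?L"
    proof
      fix z assume "z \<in> ?R"
      then obtain x f where "z = x + (\<Sum>r\<in>R. f r)" "x \<in> eigenspace A r" "\<forall>r\<in>R. f r \<in> eigenspace A r"
        by (auto simp: eigensum_def)
      \<comment> \<open>Reassigning the component at \<open>r\<close> leaves the sum over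
        \<open>R\<close> alone, since \<open>r\<close> is not in \<open>R\<close>.\<close>
      moreover have "(\<Sum>s\<in>R. f s) = (\<Sum>s\<in>R. if s = r then x else f s)"
        using insert by (intro sum.cong) auto
      ultimately show "z \<in> ?L"
        unfolding eigensum_def using insert
        by (auto intro!: exI[of _ "\<lambda>s. if s = r then x else f s"])
    qed
  qed
  moreover have "eigenspace A r \<inter> eigensum A R = {0}"
  proof -
    have "x = 0" if x: "x \<in> eigenspace A r" "x \<in> eigensum A R" for x
    proof -
      obtain f where f: "x = (\<Sum>r\<in>R. f r)" "\<forall>r\<in>R. f r \<in> eigenspace A r"
        using x(2) unfolding eigensum_def by blast
      \<comment> \<open>As an element of the eigenspace for \<open>r\<close>, the vector
        \<open>x\<close> is orthogonal to each component of its own decomposition over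
        \<open>R\<close>.\<close>
      have "cinner x x = (\<Sum>s\<in>R. cinner x (f s))"
        by (subst (2) f(1)) (simp add: cinner_sum)
      also have "\<dots> = 0"
        using x(1) f(2) insert by (intro sum.neutral) (metis A cinner_eigenspaces)
      finally show ?thesis
        by simp
    qed
    then show ?thesis
      using vec.subspace_0[OF vec_subspace_eigenspace] vec.subspace_0[OF vec_subspace_eigensum]
      by blast
  qed
  ultimately show ?case
    using insert vec.dim_sums_Int[OF vec_subspace_eigenspace[of A r] vec_subspace_eigensum[of A R]]
    by simp
qed

text \<open>The cross terms vanish by orthogonality of eigenspaces, so the sign of the form can be
  read off from the signs of the eigenvalues.\<close>

lemma cinner_eigensum:
  assumes A: "hermitian_matrix A" and "finite R" and f: "\<And>r. r \<in> R \<Longrightarrow> f r \<in> eigenspace A r"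
  shows "cinner (A *v (\<Sum>r\<in>R. f r)) (\<Sum>r\<in>R. f r) = (\<Sum>r\<in>R. r * (f r \<bullet> f r))"
proof -
  have "cinner (A *v (\<Sum>r\<in>R. f r)) (\<Sum>r\<in>R. f r) = (\<Sum>r\<in>R. \<Sum>s\<in>R. r * cinner (f r) (f s))"
    unfolding vec.sum cinner_sum(1) unfolding cinner_sum(2)
    using f by (simp add: eigenspace_def cinner_left cong: sum.cong)
  also have "\<dots> = (\<Sum>r\<in>R. \<Sum>s\<in>R. if s = r then complex_of_real (r * (f r \<bullet> f r)) else 0)"
    using f by (intro sum.cong refl) (auto simp: cinner_self intro: cinner_eigenspaces[OF A])
  also have "\<dots> = (\<Sum>r\<in>R. complex_of_real (r * (f r \<bullet> f r)))"
    using \<open>finite R\<close> by (intro sum.cong refl) (simp add: sum.delta)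
  finally show ?thesis
    by simp
qed

section \<open>Negative index of Hermitian matrices\<close>

lemma n_minus_matrix_eq_dim_eigensum:
  assumes "hermitian_matrix A"
  shows "n_minus_matrix A = vec.dim (eigensum A {r \<in> eigenvalues A. r < 0})"
  using finite_eigenvalues[OF assms]
  by (subst dim_eigensum[OF assms])
    (auto simp: n_minus_matrix_def eigenvalues_def intro!: sum.cong)

text \<open>Take the spans of the eigenvectors for negative and for nonnegative eigenvalues. The
  kernel belongs to \<open>P\<close>, so the dimensions add up to the full one and \<open>P\<close>
  can serve to bound negative definite subspaces from above.\<close>

lemma hermitian_splitting:
  fixes A :: "complex ^ 'n ^ 'n::finite"
  assumes A: "hermitian_matrix A"
  obtains N P where "vec.subspace N" "vec.subspace P"
    "vec.dim N = n_minus_matrix A" "vec.dim N + vec.dim P = CARD('n)"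
    "\<forall>x\<in>N. x \<noteq> 0 \<longrightarrow> Re (cinner (A *v x) x) < 0"
    "\<forall>x\<in>P. Re (cinner (A *v x) x) \<ge> 0"
proof
  let ?R = "eigenvalues A"
  let ?N = "eigensum A {r \<in> ?R. r < 0}" and ?P = "eigensum A {r \<in> ?R. r \<ge> 0}"
  have fin: "finite ?R"
    by (rule finite_eigenvalues[OF A])
  show "vec.subspace ?N" "vec.subspace ?P"
    by (rule vec_subspace_eigensum)+
  show "vec.dim ?N = n_minus_matrix A"
    by (rule n_minus_matrix_eq_dim_eigensum[OF A, symmetric])
  have "(\<Sum>r\<in>?R. vec.dim (eigenspace A r)) = CARD('n)"
    using dim_eigensum[OF A fin] eigensum_eq_UNIV[OF A] by (metis vec_dim_card)
  moreover have "(\<Sum>r\<in>?R. vec.dim (eigenspace A r)) =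
      (\<Sum>r | r \<in> ?R \<and> r < 0. vec.dim (eigenspace A r)) + (\<Sum>r | r \<in> ?R \<and> r \<ge> 0. vec.dim (eigenspace A r))"
    using fin by (subst sum.union_disjoint[symmetric]) (auto intro!: sum.cong)
  ultimately show "vec.dim ?N + vec.dim ?P = CARD('n)"
    using fin by (simp add: dim_eigensum[OF A])
  show "\<forall>x\<in>?N. x \<noteq> 0 \<longrightarrow> Re (cinner (A *v x) x) < 0"
  proof (intro ballI impI)
    fix x assume x: "x \<in> ?N" "x \<noteq> 0"
    obtain f where f: "x = (\<Sum>r | r \<in> ?R \<and> r < 0. f r)" "\<And>r. r \<in> {r \<in> ?R. r < 0} \<Longrightarrow> f r \<in> eigenspace A r"
      using x(1) by (auto simp: eigensum_def)
    \<comment> \<open>A nonzero vector has some nonzero component, and that component makes the sum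
      strictly negative.\<close>
    obtain s where s: "s \<in> ?R" "s < 0" "f s \<noteq> 0"
      using x(2) f(1) by (metis (mono_tags, lifting) mem_Collect_eq sum.neutral)
    have "(\<Sum>r | r \<in> ?R \<and> r < 0. r * (f r \<bullet> f r)) < (\<Sum>r | r \<in> ?R \<and> r < 0. 0)"
      using fin s by (intro sum_strict_mono_ex1) (auto simp: mult_le_0_iff mult_less_0_iff intro!: bexI[of _ s])
    then show "Re (cinner (A *v x) x) < 0"
      using cinner_eigensum[OF A _ f(2), of "{r \<in> ?R. r < 0}"] fin by (simp add: f(1))
  qed
  show "\<forall>x\<in>?P. Re (cinner (A *v x) x) \<ge> 0"
  proof
    fix x assume x: "x \<in> ?P"
    obtain f where f: "x = (\<Sum>r | r \<in> ?R \<and> r \<ge> 0. f r)" "\<And>r. r \<in> {r \<in> ?R. r \<ge> 0} \<Longrightarrow> f r \<in> eigenspace A r"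
      using x(1) by (auto simp: eigensum_def)
    then show "Re (cinner (A *v x) x) \<ge> 0"
      using cinner_eigensum[OF A _ f(2), of "{r \<in> ?R. r \<ge> 0}"] fin by (auto simp: f(1) intro!: sum_nonneg)
  qed
qed

lemma matrix_vector_mult_minus_left: "- A *v x = - (A *v (x :: complex ^ 'n))"
  by (simp add: matrix_vector_mult_def vec_eq_iff sum_negf)

lemma eigenspace_minus: "eigenspace (- A) r = eigenspace A (- r)"
  unfolding eigenspace_def matrix_vector_mult_minus_left
  by (metis (no_types, opaque_lifting) add.inverse_inverse of_real_minus vec.scale_minus_left)

text \<open>Negating the matrix negates its eigenvalues, so the three summands are the total
  multiplicities of the negative, the positive and the zero eigenvalues.\<close>

lemma n_minus_matrix_minus:
  fixes A :: "complex ^ 'n ^ 'n::finite"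
  assumes A: "hermitian_matrix A"
  shows "n_minus_matrix A + n_minus_matrix (- A) + vec.dim {x. A *v x = 0} = CARD('n)"
proof -
  let ?R = "eigenvalues A" and ?d = "\<lambda>r. vec.dim (eigenspace A r)"
  have fin: "finite ?R"
    by (rule finite_eigenvalues[OF A])
  have "n_minus_matrix A = (\<Sum>r | r \<in> ?R \<and> r < 0. ?d r)"
    using fin by (simp add: n_minus_matrix_eq_dim_eigensum[OF A] dim_eigensum[OF A])
  moreover have "n_minus_matrix (- A) = (\<Sum>r | r \<in> ?R \<and> r > 0. ?d r)"
    unfolding n_minus_matrix_def eigenspace_minus
    by (rule sum.reindex_bij_witness[of _ uminus uminus]) (auto simp: eigenvalues_def)
  moreover have "vec.dim {x. A *v x = 0} = (\<Sum>r | r \<in> ?R \<and> r = 0. ?d r)"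
  proof -
    \<comment> \<open>If 0 is not an eigenvalue, its eigenspace contributes dimension 0, so both
      cases fit one sum over \<open>{0}\<close>.\<close>
    have "eigenspace A 0 \<subseteq> {0}" if "0 \<notin> ?R"
      using that by (auto simp: eigenvalues_def)
    then have "(\<Sum>r | r \<in> ?R \<and> r = 0. ?d r) = (\<Sum>r\<in>{0}. ?d r)"
      by (intro sum.mono_neutral_left) (auto simp: vec.dim_eq_0)
    also have "\<dots> = vec.dim {x. A *v x = 0}"
      by (simp add: eigenspace_def)
    finally show ?thesis ..
  qed
  moreover have "(\<Sum>r\<in>?R. ?d r) = CARD('n)"
    using dim_eigensum[OF A fin] eigensum_eq_UNIV[OF A] by (metis vec_dim_card)
  moreover have "(\<Sum>r\<in>?R. ?d r) =
    (\<Sum>r | r \<in> ?R \<and> r < 0. ?d r) + (\<Sum>r | r \<in> ?R \<and> r > 0. ?d r) + (\<Sum>r | r \<in> ?R \<and> r = 0. ?d r)"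
    using fin
    by (simp flip: sum.union_disjoint add: disjoint_iff) (auto intro!: sum.cong)
  ultimately show ?thesis
    by simp
qed

lemma dim_sum_le_dim_Int:
  fixes S T :: "(complex ^ 'n::finite) set"
  assumes "vec.subspace S" "vec.subspace T"
  shows "vec.dim S + vec.dim T \<le> CARD('n) + vec.dim (S \<inter> T)"
proof -
  have "vec.dim {x + y |x y. x \<in> S \<and> y \<in> T} \<le> CARD('n)"
    using vec.dim_subset[OF subset_UNIV] unfolding vec_dim_card .
  then show ?thesis
    using vec.dim_sums_Int[OF assms] by linarith
qed

text \<open>On \<open>P1 \<inter> P2\<close> the form of \<open>A + B\<close> is nonnegative, so
  this intersection meets \<open>N\<close> trivially; its codimension is at most the sum of the two
  negative indices.\<close>

lemma n_minus_matrix_add: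
  fixes A B :: "complex ^ 'n ^ 'n::finite"
  assumes A: "hermitian_matrix A" and B: "hermitian_matrix B" and AB: "hermitian_matrix (A + B)"
  shows "n_minus_matrix (A + B) \<le> n_minus_matrix A + n_minus_matrix B"
proof -
  obtain N1 P1 where 1: "vec.subspace N1" "vec.subspace P1"
    "vec.dim N1 = n_minus_matrix A" "vec.dim N1 + vec.dim P1 = CARD('n)"
    "\<forall>x\<in>N1. x \<noteq> 0 \<longrightarrow> Re (cinner (A *v x) x) < 0"
    "\<forall>x\<in>P1. Re (cinner (A *v x) x) \<ge> 0"
    by (rule hermitian_splitting[OF A])
  obtain N2 P2 where 2: "vec.subspace N2" "vec.subspace P2"
    "vec.dim N2 = n_minus_matrix B" "vec.dim N2 + vec.dim P2 = CARD('n)"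
    "\<forall>x\<in>N2. x \<noteq> 0 \<longrightarrow> Re (cinner (B *v x) x) < 0"
    "\<forall>x\<in>P2. Re (cinner (B *v x) x) \<ge> 0"
    by (rule hermitian_splitting[OF B])
  obtain N P where 3: "vec.subspace N" "vec.subspace P"
    "vec.dim N = n_minus_matrix (A + B)" "vec.dim N + vec.dim P = CARD('n)"
    "\<forall>x\<in>N. x \<noteq> 0 \<longrightarrow> Re (cinner ((A + B) *v x) x) < 0"
    "\<forall>x\<in>P. Re (cinner ((A + B) *v x) x) \<ge> 0"
    by (rule hermitian_splitting[OF AB])
  have "N \<inter> (P1 \<inter> P2) \<subseteq> {0}"
    using 1(6) 2(6) 3(5) by (force simp: matrix_vector_mult_add_rdistrib cinner_left)
  then have "vec.dim (N \<inter> (P1 \<inter> P2)) = 0"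
    by (simp add: vec.dim_eq_0)
  moreover have "vec.subspace (P1 \<inter> P2)"
    using 1 2 by (simp add: vec.subspace_inter)
  ultimately show ?thesis
    using dim_sum_le_dim_Int[OF 1(2) 2(2)] dim_sum_le_dim_Int[OF 3(1), of "P1 \<inter> P2"] 1 2 3
    by linarith
qed

interpretation vec_cpair: finite_dimensional_vector_space_pair
  "(*s) :: complex \<Rightarrow> complex ^ 'n \<Rightarrow> complex ^ 'n::finite" cart_basis
  "scale2 :: complex \<Rightarrow> 'n cpair \<Rightarrow> 'n::finite cpair" prod2.Basis_pair
  ..

interpretation vec_ctriple: finite_dimensional_vector_space_pair
  "(*s) :: complex \<Rightarrow> complex ^ 'n \<Rightarrow> complex ^ 'n::finite" cart_basis
  "scale3 :: complex \<Rightarrow> 'n ctriple \<Rightarrow> 'n::finite ctriple" prod222.Basis_pair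
  ..

interpretation ctriple_pair: finite_dimensional_vector_space_pair
  "scale3 :: complex \<Rightarrow> 'n ctriple \<Rightarrow> 'n::finite ctriple" prod222.Basis_pair
  "scale3 :: complex \<Rightarrow> 'n ctriple \<Rightarrow> 'n::finite ctriple" prod222.Basis_pair
  ..

subsection \<open>Negative index of a form\<close>

text \<open>A negative definite subspace meets \<open>P\<close> trivially, hence has dimension at
  most that of \<open>V\<close> minus that of \<open>P\<close>. This replaces the maximum in
  \<open>n_minus_form\<close> by exhibiting one pair of subspaces.\<close>

lemma n_minus_form_splitting:
  assumes V: "ctriple.subspace V" and N: "ctriple.subspace N" "N \<subseteq> V" and P: "ctriple.subspace P" "P \<subseteq> V"
    and dim: "ctriple.dim N + ctriple.dim P = ctriple.dim V"
    and neg: "\<And>w. w \<in> N \<Longrightarrow> w \<noteq> 0 \<Longrightarrow> Re (B w w) < 0"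
    and nonneg: "\<And>w. w \<in> P \<Longrightarrow> Re (B w w) \<ge> 0"
  shows "n_minus_form V B = ctriple.dim N"
  unfolding n_minus_form_def
proof (rule Max_eqI)
  show "finite {ctriple.dim W | W. ctriple.subspace W \<and> W \<subseteq> V \<and> (\<forall>w\<in>W. w \<noteq> 0 \<longrightarrow> Re (B w w) < 0)}"
    by (rule n_minus_form_set_finite_nonempty[OF V])
  show "ctriple.dim N \<in> {ctriple.dim W | W. ctriple.subspace W \<and> W \<subseteq> V \<and> (\<forall>w\<in>W. w \<noteq> 0 \<longrightarrow> Re (B w w) < 0)}"
    using N neg by blast
next
  fix d
  assume "d \<in> {ctriple.dim W | W. ctriple.subspace W \<and> W \<subseteq> V \<and> (\<forall>w\<in>W. w \<noteq> 0 \<longrightarrow> Re (B w w) < 0)}"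
  then obtain W where W: "d = ctriple.dim W" "ctriple.subspace W" "W \<subseteq> V"
    "\<And>w. w \<in> W \<Longrightarrow> w \<noteq> 0 \<Longrightarrow> Re (B w w) < 0"
    by blast
  have "W \<inter> P \<subseteq> {0}"
    using W(4) nonneg by force
  then have "ctriple.dim (W \<inter> P) = 0"
    unfolding ctriple.dim_eq_0 .
  moreover have "{x + y |x y. x \<in> W \<and> y \<in> P} \<subseteq> V"
    using W(3) P(2) ctriple.subspace_add[OF V] by blast
  then have "ctriple.dim {x + y |x y. x \<in> W \<and> y \<in> P} \<le> ctriple.dim V"
    by (rule ctriple.dim_subset)
  ultimately show "d \<le> ctriple.dim N"
    using ctriple.dim_sums_Int[OF W(2) P(1)] dim W(1) by linarith
qed

text \<open>Three maps serve as linear coordinates on a space of triples. Restricting the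
  coordinates to \<open>S\<close>, \<open>T\<close>, \<open>U\<close> allows the spectral splittings
  of three diagonal blocks to be assembled.\<close>

definition sum_images ::
  "(complex ^ 'n \<Rightarrow> 'n ctriple) \<Rightarrow> (complex ^ 'n \<Rightarrow> 'n ctriple) \<Rightarrow> (complex ^ 'n \<Rightarrow> 'n ctriple) \<Rightarrow>
   (complex ^ 'n) set \<Rightarrow> (complex ^ 'n) set \<Rightarrow> (complex ^ 'n) set \<Rightarrow> 'n::finite ctriple set" where
  "sum_images f g h S T U = {f a + g b + h c | a b c. a \<in> S \<and> b \<in> T \<and> c \<in> U}"

context
  fixes f g h :: "complex ^ 'n \<Rightarrow> 'n::finite ctriple"
  assumes lin: "Vector_Spaces.linear (*s) scale3 f" "Vector_Spaces.linear (*s) scale3 g"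
      "Vector_Spaces.linear (*s) scale3 h"
    and indep: "\<And>a b c. f a + g b + h c = 0 \<Longrightarrow> a = 0 \<and> b = 0 \<and> c = 0"
begin

text \<open>Joint independence makes each map injective and the sum of the images direct; the
  dimension formula is applied first to two images and then to the third.\<close>

lemma subspace_and_dim_sum_images:
  assumes S: "vec.subspace S" and T: "vec.subspace T" and U: "vec.subspace U"
  shows "ctriple.subspace (sum_images f g h S T U)"
    and "ctriple.dim (sum_images f g h S T U) = vec.dim S + vec.dim T + vec.dim U"
proof -
  have zero: "f 0 = 0" "g 0 = 0" "h 0 = 0"
    using lin by (simp_all add: vec_ctriple.linear_0)
  have sub: "ctriple.subspace (f ` S)" "ctriple.subspace (g ` T)" "ctriple.subspace (h ` U)"
    using vec_ctriple.linear_subspace_image lin S T U by blast+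
  have "inj f" "inj g" "inj h"
    unfolding vec_ctriple.linear_inj_iff_eq_0[OF lin(1)] vec_ctriple.linear_inj_iff_eq_0[OF lin(2)]
      vec_ctriple.linear_inj_iff_eq_0[OF lin(3)]
    using indep[of _ 0 0] indep[of 0 _ 0] indep[of 0 0] zero by simp_all
  then have dims: "ctriple.dim (f ` S) = vec.dim S" "ctriple.dim (g ` T) = vec.dim T" "ctriple.dim (h ` U) = vec.dim U"
    using lin by (auto intro!: vec_ctriple.dim_image_eq intro: inj_on_subset)
  define K where "K = {x + y |x y. x \<in> f ` S \<and> y \<in> g ` T}"
  have eq: "sum_images f g h S T U = {x + y |x y. x \<in> K \<and> y \<in> h ` U}"
    unfolding sum_images_def K_def by blast
  have K: "ctriple.subspace K"
    unfolding K_def by (intro ctriple.subspace_sums sub)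
  show "ctriple.subspace (sum_images f g h S T U)"
    unfolding eq by (intro ctriple.subspace_sums K sub)
  have "f ` S \<inter> g ` T \<subseteq> {0}"
  proof
    fix w assume "w \<in> f ` S \<inter> g ` T"
    then obtain a b where w: "w = f a" "w = g b"
      by blast
    then have "f a + g (- b) + h 0 = 0"
      by (simp add: vec_ctriple.linear_neg[OF lin(2)] zero)
    from indep[OF this] show "w \<in> {0}"
      by (simp add: w(1) zero)
  qed
  then have "ctriple.dim (f ` S \<inter> g ` T) = 0"
    unfolding ctriple.dim_eq_0 .
  then have "ctriple.dim K = vec.dim S + vec.dim T"
    using ctriple.dim_sums_Int[OF sub(1,2)] dims unfolding K_def by linarith
  moreover have "K \<inter> h ` U \<subseteq> {0}"
  proof
    fix w assume "w \<in> K \<inter> h ` U"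
    then obtain a b c where w: "w = f a + g b" "w = h c"
      unfolding K_def by blast
    then have "f a + g b + h (- c) = 0"
      by (simp add: vec_ctriple.linear_neg[OF lin(3)])
    from indep[OF this] show "w \<in> {0}"
      by (simp add: w(2) zero)
  qed
  then have "ctriple.dim (K \<inter> h ` U) = 0"
    unfolding ctriple.dim_eq_0 .
  ultimately show "ctriple.dim (sum_images f g h S T U) = vec.dim S + vec.dim T + vec.dim U"
    using ctriple.dim_sums_Int[OF K sub(3)] dims unfolding eq by linarith
qed

text \<open>The splittings of the three blocks add up to a splitting of the whole form. The positive
  factor \<open>k\<close> does not change signs; it accommodates the factor 2 in
  \<open>Re_Omega_self\<close>.\<close>

lemma n_minus_form_diagonal:
  fixes P Q R :: "complex ^ 'n ^ 'n" and k :: real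
  assumes herm: "hermitian_matrix P" "hermitian_matrix Q" "hermitian_matrix R" and "k > 0"
    and B: "\<And>a b c. Re (B (f a + g b + h c) (f a + g b + h c)) =
      k * (Re (cinner (P *v a) a) + Re (cinner (Q *v b) b) + Re (cinner (R *v c) c))"
  shows "n_minus_form (sum_images f g h UNIV UNIV UNIV) B =
    n_minus_matrix P + n_minus_matrix Q + n_minus_matrix R"
proof -
  obtain N1 P1 where 1: "vec.subspace N1" "vec.subspace P1"
    "vec.dim N1 = n_minus_matrix P" "vec.dim N1 + vec.dim P1 = CARD('n)"
    "\<forall>x\<in>N1. x \<noteq> 0 \<longrightarrow> Re (cinner (P *v x) x) < 0" "\<forall>x\<in>P1. Re (cinner (P *v x) x) \<ge> 0"
    by (rule hermitian_splitting[OF herm(1)])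
  obtain N2 P2 where 2: "vec.subspace N2" "vec.subspace P2"
    "vec.dim N2 = n_minus_matrix Q" "vec.dim N2 + vec.dim P2 = CARD('n)"
    "\<forall>x\<in>N2. x \<noteq> 0 \<longrightarrow> Re (cinner (Q *v x) x) < 0" "\<forall>x\<in>P2. Re (cinner (Q *v x) x) \<ge> 0"
    by (rule hermitian_splitting[OF herm(2)])
  obtain N3 P3 where 3: "vec.subspace N3" "vec.subspace P3"
    "vec.dim N3 = n_minus_matrix R" "vec.dim N3 + vec.dim P3 = CARD('n)"
    "\<forall>x\<in>N3. x \<noteq> 0 \<longrightarrow> Re (cinner (R *v x) x) < 0" "\<forall>x\<in>P3. Re (cinner (R *v x) x) \<ge> 0"
    by (rule hermitian_splitting[OF herm(3)])
  note dims = subspace_and_dim_sum_images(2)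
  let ?V = "sum_images f g h UNIV UNIV UNIV" and ?N = "sum_images f g h N1 N2 N3"
    and ?P = "sum_images f g h P1 P2 P3"
  have "n_minus_form ?V B = ctriple.dim ?N"
  proof (rule n_minus_form_splitting)
    show "ctriple.subspace ?V" "ctriple.subspace ?N" "ctriple.subspace ?P"
      by (intro subspace_and_dim_sum_images(1) vec.subspace_UNIV 1 2 3)+
    show "?N \<subseteq> ?V" "?P \<subseteq> ?V"
      unfolding sum_images_def by blast+
    have "ctriple.dim ?V = CARD('n) + CARD('n) + CARD('n)"
      using dims[OF vec.subspace_UNIV vec.subspace_UNIV vec.subspace_UNIV] unfolding vec_dim_card .
    then show "ctriple.dim ?N + ctriple.dim ?P = ctriple.dim ?V"
      using 1(4) 2(4) 3(4) dims[OF 1(1) 2(1) 3(1)] dims[OF 1(2) 2(2) 3(2)] by linarith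
  next
    fix w assume "w \<in> ?N" "w \<noteq> 0"
    then obtain a b c where w: "w = f a + g b + h c" "a \<in> N1" "b \<in> N2" "c \<in> N3"
      unfolding sum_images_def by blast
    \<comment> \<open>The zero vector is covered separately because definiteness speaks of nonzero
      vectors only; at least one of the three values is strictly negative below.\<close>
    have nonpos: "Re (cinner (P *v a) a) \<le> 0" "Re (cinner (Q *v b) b) \<le> 0" "Re (cinner (R *v c) c) \<le> 0"
      using w 1(5) 2(5) 3(5) by (cases "a = 0"; cases "b = 0"; cases "c = 0"; force)+
    have "a \<noteq> 0 \<or> b \<noteq> 0 \<or> c \<noteq> 0"
      using \<open>w \<noteq> 0\<close> w(1) lin by (auto simp: vec_ctriple.linear_0)
    then have "Re (cinner (P *v a) a) + Re (cinner (Q *v b) b) + Re (cinner (R *v c) c) < 0"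
      using nonpos w 1(5) 2(5) 3(5) by (smt (verit))
    then show "Re (B w w) < 0"
      using \<open>k > 0\<close> by (simp add: w(1) B mult_less_0_iff)
  next
    fix w assume "w \<in> ?P"
    then obtain a b c where w: "w = f a + g b + h c" "a \<in> P1" "b \<in> P2" "c \<in> P3"
      unfolding sum_images_def by blast
    then show "Re (B w w) \<ge> 0"
      using \<open>k > 0\<close> 1(6) 2(6) 3(6) by (simp add: B)
  qed
  then show ?thesis
    using dims[OF 1(1) 2(1) 3(1)] 1(3) 2(3) 3(3) by simp
qed

end

subsection \<open>The index of three graphs\<close>

text \<open>On the diagonal the three terms with a minus sign are, sign included, the conjugates of
  the other three, whence the factor 2.\<close>

lemma Re_Omega_self: "Re (Omega (u, v, w) (u, v, w)) = 2 * (Re (sympl u v) + Re (sympl v w) + Re (sympl w u))"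
proof -
  have "Re (sympl v u) = - Re (sympl u v)" for u v :: "'a cpair"
    using arg_cong[OF sympl_commute[of u v], of Re] by simp
  from this[of u v] this[of v w] this[of w u] show ?thesis
    by simp
qed

lemma hermitian_matrix_inner_commute:
  "hermitian_matrix A \<Longrightarrow> (A *v x) \<bullet> y = (A *v y) \<bullet> x"
  using hermitian_matrix_cinner[of A x y] by (metis Re_cinner inner_commute)

lemma Re_sympl_graphs:
  assumes "hermitian_matrix B"
  shows "Re (sympl (x, A *v x) (y, B *v y)) = (B *v x) \<bullet> y - (A *v x) \<bullet> y"
  by (simp add: sympl_def hermitian_matrix_cinner[OF assms, symmetric] Re_cinner)

text \<open>
  With \<open>x\<^sub>1 = b + c\<close>, \<open>x\<^sub>2 = a + c\<close>, \<open>x\<^sub>3 = a + b\<close> as coordinates on the three graphs, the mixed terms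
  cancel because the matrices \<open>A3 - A2\<close>, \<open>A1 - A3\<close>, \<open>A2 - A1\<close> add up to zero.
\<close>

lemma n_minus_form_graphs:
  fixes A1 A2 A3 :: "complex ^ 'n ^ 'n::finite"
  assumes herm: "hermitian_matrix A1" "hermitian_matrix A2" "hermitian_matrix A3"
  shows "n_minus_form (graph_plane A1 \<times> graph_plane A2 \<times> graph_plane A3) Omega =
    n_minus_matrix (A3 - A2) + n_minus_matrix (A1 - A3) + n_minus_matrix (A2 - A1)"
proof -
  define f g h :: "complex ^ 'n \<Rightarrow> 'n ctriple" where
    "f x = (0, (x, A2 *v x), (x, A3 *v x))" and
    "g x = ((x, A1 *v x), 0, (x, A3 *v x))" and
    "h x = ((x, A1 *v x), (x, A2 *v x), 0)" for x
  note defs = f_def g_def h_def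
  have sum: "f a + g b + h c =
    ((b + c, A1 *v (b + c)), (a + c, A2 *v (a + c)), (a + b, A3 *v (a + b)))" for a b c
    by (simp add: defs matrix_vector_right_distrib)
  have V: "graph_plane A1 \<times> graph_plane A2 \<times> graph_plane A3 = sum_images f g h UNIV UNIV UNIV" (is "?L = ?R")
  proof
    show "?R \<subseteq> ?L"
      unfolding sum_images_def sum by (auto simp: graph_plane_def)
    show "?L \<subseteq> ?R"
    proof
      fix w assume "w \<in> ?L"
      then obtain x y z where w: "w = ((x, A1 *v x), (y, A2 *v y), (z, A3 *v z))"
        by (auto simp: graph_plane_def)
      \<comment> \<open>These solve the system \<open>b + c = x\<close>, \<open>a + c = y\<close>,
        \<open>a + b = z\<close>.\<close>
      define a b c where "a = (1/2) *s (y + z - x)" and "b = (1/2) *s (x + z - y)" and "c = (1/2) *s (x + y - z)"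
      have "b + c = x" "a + c = y" "a + b = z"
        by (simp_all add: a_def b_def c_def vec_eq_iff field_simps)
      then have "w = f a + g b + h c"
        by (simp add: sum w)
      then show "w \<in> ?R"
        unfolding sum_images_def by blast
    qed
  qed
  have "Vector_Spaces.linear (*s) scale3 f" "Vector_Spaces.linear (*s) scale3 g" "Vector_Spaces.linear (*s) scale3 h"
    unfolding Vector_Spaces.linear_iff
    by (simp_all add: vec.vector_space_axioms ctriple.vector_space_axioms defs scale3_def scale2_def
        matrix_vector_right_distrib vec.scale zero_prod_def)
  moreover have "a = 0 \<and> b = 0 \<and> c = 0" if "f a + g b + h c = 0" for a b c
  proof -
    have "b + c = 0" "a + c = 0" "a + b = 0"
      using that by (simp_all add: sum zero_prod_def)
    moreover have "a = (1/2) *s ((a + c) + (a + b) - (b + c))" "b = (1/2) *s ((b + c) + (a + b) - (a + c))"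
      "c = (1/2) *s ((b + c) + (a + c) - (a + b))"
      by (simp_all add: vec_eq_iff)
    ultimately show ?thesis
      by simp
  qed
  moreover have "Re (Omega (f a + g b + h c) (f a + g b + h c)) =
    2 * (Re (cinner ((A3 - A2) *v a) a) + Re (cinner ((A1 - A3) *v b) b) + Re (cinner ((A2 - A1) *v c) c))" for a b c
    unfolding sum Re_Omega_self Re_sympl_graphs[OF herm(1)] Re_sympl_graphs[OF herm(2)]
      Re_sympl_graphs[OF herm(3)] Re_cinner
    \<comment> \<open>A mixed term occurs with its arguments in either order; these symmetries align
      the orders so that the cancellation becomes visible.\<close>
    using hermitian_matrix_inner_commute[OF herm(1), of b a] hermitian_matrix_inner_commute[OF herm(1), of c a]
      hermitian_matrix_inner_commute[OF herm(1), of c b]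
      hermitian_matrix_inner_commute[OF herm(2), of b a] hermitian_matrix_inner_commute[OF herm(2), of c a]
      hermitian_matrix_inner_commute[OF herm(2), of c b]
      hermitian_matrix_inner_commute[OF herm(3), of b a] hermitian_matrix_inner_commute[OF herm(3), of c a]
      hermitian_matrix_inner_commute[OF herm(3), of c b]
    by (simp add: matrix_vector_right_distrib matrix_vector_mult_diff_rdistrib inner_add_left
        inner_add_right inner_diff_left)
  ultimately show ?thesis
    unfolding V by (intro n_minus_form_diagonal[where k = 2]) (simp_all add: hermitian_matrix_diff herm)
qed

lemma dim_Int_graph_planes:
  fixes A B :: "complex ^ 'n ^ 'n::finite"
  shows "cpair.dim (graph_plane A \<inter> graph_plane B) = vec.dim {x. (B - A) *v x = 0}"
proof -
  define f where "f x = (x, A *v x)" for x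
  have "graph_plane A \<inter> graph_plane B = f ` {x. (B - A) *v x = 0}"
    by (auto simp: graph_plane_def f_def matrix_vector_mult_diff_rdistrib)
  moreover have "Vector_Spaces.linear (*s) scale2 f"
    unfolding Vector_Spaces.linear_iff
    by (simp add: vec.vector_space_axioms cpair.vector_space_axioms f_def scale2_def
        matrix_vector_right_distrib vec.scale)
  moreover have "inj_on f X" for X
    by (rule inj_onI) (simp add: f_def)
  ultimately show ?thesis
    by (simp add: vec_cpair.dim_image_eq)
qed

text \<open>The block \<open>A1 - A3\<close> enters with the wrong sign. Exchanging its index for
  that of \<open>A3 - A1\<close> costs exactly the dimension of the space minus that of the kernel
  of \<open>A3 - A1\<close>, which is the normalisation built into \<open>iota\<close>.\<close>

proposition iota_graph_planes:
  fixes A1 A2 A3 :: "complex ^ 'n ^ 'n::finite"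
  assumes herm: "hermitian_matrix A1" "hermitian_matrix A2" "hermitian_matrix A3"
  shows "iota (graph_plane A1) (graph_plane A2) (graph_plane A3) =
    int (n_minus_matrix (A2 - A1)) + int (n_minus_matrix (A3 - A2)) - int (n_minus_matrix (A3 - A1))"
  using n_minus_matrix_minus[OF hermitian_matrix_diff[OF herm(3,1)]]
  by (simp add: iota_def n_minus_form_graphs[OF herm] dim_Int_graph_planes)

section \<open>The index of the zero graph, a graph and the infinity plane\<close>

lemma hermitian_matrix_mat_1: "hermitian_matrix (mat 1)"
  by (simp add: hermitian_matrix_def mat_def)

lemma n_minus_matrix_mat_1: "n_minus_matrix (mat 1 :: complex ^ 'n ^ 'n::finite) = 0"
proof -
  have "x = 0" if "r < 0" "x \<in> eigenspace (mat 1) r" for r :: real and x :: "complex ^ 'n"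
  proof -
    have "(1 - complex_of_real r) *s x = 0"
      using that(2) by (simp add: eigenspace_def vec.scale_left_diff_distrib)
    moreover have "1 - complex_of_real r \<noteq> 0"
      using that(1) by (metis of_real_1 of_real_eq_iff right_minus_eq not_one_less_zero)
    ultimately show ?thesis
      using vec.scale_eq_0_iff by blast
  qed
  then have "{r. r < 0 \<and> (\<exists>x. x \<noteq> 0 \<and> x \<in> eigenspace (mat 1 :: complex ^ 'n ^ 'n) r)} = {}"
    by blast
  then show ?thesis
    unfolding n_minus_matrix_def by (simp only: sum.empty)
qed

text \<open>The hyperbolic form below has the blocks \<open>mat 1\<close> and
  \<open>- mat 1\<close>; together they contribute \<open>CARD('n')\<close>, which offsets the
  subtracted dimension in \<open>iota\<close>.\<close>

lemma n_minus_matrix_minus_mat_1: "n_minus_matrix (- mat 1 :: complex ^ 'n ^ 'n::finite) = CARD('n)"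
  using n_minus_matrix_minus[OF hermitian_matrix_mat_1, where 'n = 'n]
  by (simp add: n_minus_matrix_mat_1)

text \<open>
  Here \<open>\<Omega>\<close> is the sum of the form of \<open>A\<close> and of a hyperbolic form, which is diagonal in the
  coordinates \<open>p, q\<close>.
\<close>

proposition iota_zero_graph_infinity:
  fixes A :: "complex ^ 'n ^ 'n::finite"
  assumes A: "hermitian_matrix A"
  shows "iota (graph_plane 0) (graph_plane A) infinity_plane = int (n_minus_matrix A)"
proof -
  \<comment> \<open>For the triple \<open>(x, 0)\<close>, \<open>(y, A *v y)\<close>,
    \<open>(0, z)\<close> the shifts \<open>x = y + x'\<close> and \<open>z = A *v y + z'\<close>
    remove the mixed terms with \<open>y\<close> and leave the form of \<open>A\<close> at
    \<open>y\<close> minus the real inner product of \<open>x'\<close> and \<open>z'\<close>. With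
    \<open>x' = q - p\<close> and \<open>z' = q + p\<close> the latter becomes a difference of
    squares.\<close>
  define f g h :: "complex ^ 'n \<Rightarrow> 'n ctriple" where
    "f y = ((y, 0), (y, A *v y), (0, A *v y))" and
    "g p = ((- p, 0), 0, (0, p))" and
    "h q = ((q, 0), 0, (0, q))" for y p q
  note defs = f_def g_def h_def
  have sum: "f y + g p + h q = ((y - p + q, 0), (y, A *v y), (0, A *v y + p + q))" for y p q
    by (simp add: defs)
  have V: "graph_plane 0 \<times> graph_plane A \<times> infinity_plane = sum_images f g h UNIV UNIV UNIV" (is "?L = ?R")
  proof
    show "?R \<subseteq> ?L"
      unfolding sum_images_def sum by (auto simp: graph_plane_def infinity_plane_def)
    show "?L \<subseteq> ?R"
    proof
      fix w assume "w \<in> ?L"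
      then obtain x y z where w: "w = ((x, 0), (y, A *v y), (0, z))"
        by (auto simp: graph_plane_def infinity_plane_def)
      define p q where "p = (1/2) *s (z - A *v y + y - x)" and "q = (1/2) *s (z - A *v y - y + x)"
      have "y - p + q = x" "A *v y + p + q = z"
        by (simp_all add: p_def q_def vec_eq_iff field_simps)
      then have "w = f y + g p + h q"
        by (simp add: sum w)
      then show "w \<in> ?R"
        unfolding sum_images_def by blast
    qed
  qed
  have "Vector_Spaces.linear (*s) scale3 f" "Vector_Spaces.linear (*s) scale3 g" "Vector_Spaces.linear (*s) scale3 h"
    unfolding Vector_Spaces.linear_iff
    by (simp_all add: vec.vector_space_axioms ctriple.vector_space_axioms defs scale3_def scale2_def
        matrix_vector_right_distrib vec.scale zero_prod_def)
  moreover have "y = 0 \<and> p = 0 \<and> q = 0" if "f y + g p + h q = 0" for y p q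
  proof -
    have "y = 0" "q - p = 0" "p + q = 0"
      using that by (auto simp: sum zero_prod_def)
    moreover have "p = (1/2) *s ((p + q) - (q - p))" "q = (1/2) *s ((p + q) + (q - p))"
      by (simp_all add: vec_eq_iff)
    ultimately show ?thesis
      by simp
  qed
  moreover have "Re (Omega (f y + g p + h q) (f y + g p + h q)) =
    2 * (Re (cinner (A *v y) y) + Re (cinner (mat 1 *v p) p) + Re (cinner (- mat 1 *v q) q))" for y p q
  proof -
    have "- mat 1 *v q = - q"
      by (simp add: matrix_vector_mult_minus_left)
    then show ?thesis
      unfolding sum Re_Omega_self
      by (simp add: sympl_def Re_cinner inner_add_left inner_add_right inner_diff_left
          inner_diff_right inner_commute)
  qed
  ultimately have "n_minus_form (graph_plane 0 \<times> graph_plane A \<times> infinity_plane) Omega =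
      n_minus_matrix A + n_minus_matrix (mat 1 :: complex ^ 'n ^ 'n) + n_minus_matrix (- mat 1 :: complex ^ 'n ^ 'n)"
    unfolding V
    by (intro n_minus_form_diagonal[where k = 2])
      (simp_all add: A hermitian_matrix_mat_1 hermitian_matrix_minus)
  moreover have "graph_plane 0 \<inter> infinity_plane = {0 :: 'n cpair}"
    by (auto simp: graph_plane_def infinity_plane_def zero_prod_def)
  then have "cpair.dim (graph_plane 0 \<inter> infinity_plane :: 'n cpair set) = 0"
    by (simp add: cpair.dim_eq_0)
  ultimately show ?thesis
    by (simp add: iota_def n_minus_matrix_mat_1 n_minus_matrix_minus_mat_1)
qed

subsection \<open>Symplectic invariance\<close>

lemma symplectic_inv:
  assumes "symplectic S"
  shows "symplectic (inv S)"
proof -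
  have S: "Vector_Spaces.linear scale2 scale2 S" "bij S" "\<And>u v. sympl (S u) (S v) = sympl u v"
    using assms unfolding symplectic_def by blast+
  have S_inv: "S (inv S u) = u" for u
    using S(2) by (simp add: bij_is_surj surj_f_inv_f)
  have "Vector_Spaces.linear scale2 scale2 (inv S)"
    using cpair.inj_linear_imp_inv_linear[OF S(1)] S(2) by (simp add: bij_is_inj)
  moreover have "sympl (inv S u) (inv S v) = sympl u v" for u v
    using S(3)[of "inv S u" "inv S v"] by (simp add: S_inv)
  ultimately show ?thesis
    using S(2) by (simp add: symplectic_def bij_imp_bij_inv)
qed

lemma subspace_Times3:
  assumes "cpair.subspace L1" "cpair.subspace L2" "cpair.subspace L3"
  shows "ctriple.subspace (L1 \<times> L2 \<times> L3)"
  using assms by (auto simp: ctriple.subspace_def cpair.subspace_def scale3_def zero_prod_def)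

text \<open>Applying \<open>S\<close> in each component maps negative definite subspaces injectively
  to negative definite ones. One inequality is enough, because \<open>inv S\<close> is symplectic
  too and supplies the other.\<close>

lemma n_minus_form_image_le:
  assumes "symplectic S" and L: "cpair.subspace L1" "cpair.subspace L2" "cpair.subspace L3"
  shows "n_minus_form (L1 \<times> L2 \<times> L3) Omega \<le> n_minus_form (S ` L1 \<times> S ` L2 \<times> S ` L3) Omega"
proof -
  have S: "Vector_Spaces.linear scale2 scale2 S" "bij S" "\<And>u v. sympl (S u) (S v) = sympl u v"
    using assms unfolding symplectic_def by blast+
  define T where "T w = (S (fst w), S (fst (snd w)), S (snd (snd w)))" for w
  have linT: "Vector_Spaces.linear scale3 scale3 T"
    using S(1) unfolding Vector_Spaces.linear_iff
    by (simp add: ctriple.vector_space_axioms T_def scale3_def)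
  have injT: "inj T"
    by (rule injI) (simp add: T_def inj_eq[OF bij_is_inj[OF S(2)]] prod_eqI)
  have Omega_T: "Omega (T w) (T w) = Omega w w" for w
    by (cases w rule: prod_cases3) (simp add: T_def S(3))
  let ?D = "\<lambda>V. {ctriple.dim W | W. ctriple.subspace W \<and> W \<subseteq> V \<and> (\<forall>w\<in>W. w \<noteq> 0 \<longrightarrow> Re (Omega w w) < 0)}"
  have sub: "ctriple.subspace (L1 \<times> L2 \<times> L3)" "ctriple.subspace (S ` L1 \<times> S ` L2 \<times> S ` L3)"
    using L prod22.linear_subspace_image[OF S(1)] by (blast intro: subspace_Times3)+
  have "?D (L1 \<times> L2 \<times> L3) \<subseteq> ?D (S ` L1 \<times> S ` L2 \<times> S ` L3)"
  proof
    fix d assume "d \<in> ?D (L1 \<times> L2 \<times> L3)"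
    then obtain W where W: "d = ctriple.dim W" "ctriple.subspace W" "W \<subseteq> L1 \<times> L2 \<times> L3"
      "\<forall>w\<in>W. w \<noteq> 0 \<longrightarrow> Re (Omega w w) < 0"
      by blast
    have "ctriple.dim (T ` W) = d"
      using W(1) injT by (simp add: ctriple_pair.dim_image_eq[OF linT] inj_on_subset)
    moreover have "ctriple.subspace (T ` W)"
      by (rule ctriple_pair.linear_subspace_image[OF linT W(2)])
    moreover have "T ` W \<subseteq> S ` L1 \<times> S ` L2 \<times> S ` L3"
      using W(3) by (auto simp: T_def)
    moreover have "\<forall>w\<in>T ` W. w \<noteq> 0 \<longrightarrow> Re (Omega w w) < 0"
      using W(4) ctriple_pair.linear_0[OF linT] by (auto simp: Omega_T)
    ultimately show "d \<in> ?D (S ` L1 \<times> S ` L2 \<times> S ` L3)"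
      by blast
  qed
  then show ?thesis
    unfolding n_minus_form_def
    using n_minus_form_set_finite_nonempty[OF sub(1), of Omega] n_minus_form_set_finite_nonempty[OF sub(2), of Omega]
    by (intro Max_mono) simp_all
qed

proposition iota_symplectic_image:
  assumes "symplectic S" and L: "cpair.subspace L1" "cpair.subspace L2" "cpair.subspace L3"
  shows "iota (S ` L1) (S ` L2) (S ` L3) = iota L1 L2 L3"
proof -
  have S: "Vector_Spaces.linear scale2 scale2 S" "bij S"
    using assms unfolding symplectic_def by blast+
  have inj: "inj S"
    using S(2) by (rule bij_is_inj)
  have "cpair.dim (S ` L1 \<inter> S ` L3) = cpair.dim (L1 \<inter> L3)"
    unfolding image_Int[OF inj, symmetric] using inj
    by (simp add: prod22.dim_image_eq[OF S(1)] inj_on_subset)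
  moreover have "n_minus_form (S ` L1 \<times> S ` L2 \<times> S ` L3) Omega = n_minus_form (L1 \<times> L2 \<times> L3) Omega"
  proof (rule antisym)
    have "n_minus_form (S ` L1 \<times> S ` L2 \<times> S ` L3) Omega
      \<le> n_minus_form (inv S ` S ` L1 \<times> inv S ` S ` L2 \<times> inv S ` S ` L3) Omega"
      using L prod22.linear_subspace_image[OF S(1)]
      by (intro n_minus_form_image_le symplectic_inv assms(1))
    then show "n_minus_form (S ` L1 \<times> S ` L2 \<times> S ` L3) Omega \<le> n_minus_form (L1 \<times> L2 \<times> L3) Omega"
      using inj by (simp add: image_inv_f_f)
  qed (rule n_minus_form_image_le[OF assms])
  ultimately show ?thesis
    by (simp add: iota_def)
qed

lemma lagrangian_image:
  assumes "symplectic S" and L: "lagrangian L"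
  shows "lagrangian (S ` L)"
proof -
  have S: "Vector_Spaces.linear scale2 scale2 S" "bij S" "\<And>u v. sympl (S u) (S v) = sympl u v"
    using assms unfolding symplectic_def by blast+
  have sub: "cpair.subspace L" and eq: "\<And>v. v \<in> L \<longleftrightarrow> (\<forall>u\<in>L. sympl u v = 0)"
    using L unfolding lagrangian_def by blast+
  have "S v \<in> S ` L \<longleftrightarrow> (\<forall>u\<in>S ` L. sympl u (S v) = 0)" for v
    using eq[of v] S(3) inj_image_mem_iff[OF bij_is_inj[OF S(2)]] by simp
  then have "w \<in> S ` L \<longleftrightarrow> (\<forall>u\<in>S ` L. sympl u w = 0)" for w
    using bij_is_surj[OF S(2)] by (metis surjD)
  then show ?thesis
    unfolding lagrangian_def using prod22.linear_subspace_image[OF S(1) sub] by blast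
qed

subsection \<open>Reduction to graphs\<close>

lemma cinner_axis: "cinner (axis j 1) x = cnj (x $ j)" "cinner x (axis j 1) = x $ j"
proof -
  have "axis j 1 $ i * cnj (x $ i) = (if i = j then cnj (x $ j) else 0)"
    "x $ i * cnj (axis j 1 $ i) = (if i = j then x $ j else 0)" for i
    by (auto simp: axis_def)
  then show "cinner (axis j 1) x = cnj (x $ j)" "cinner x (axis j 1) = x $ j"
    by (simp_all add: cinner_def)
qed

text \<open>Transversality to the infinity plane acts twice: the fibres over the first component
  have at most one point, and, since \<open>L\<close> is its own symplectic complement, the first
  projection is onto. The isotropy of \<open>L\<close> then makes the resulting matrix
  Hermitian.\<close>

lemma lagrangian_graph_plane:
  fixes L :: "'n::finite cpair set"
  assumes L: "lagrangian L" and transversal: "\<And>y. (0, y) \<in> L \<Longrightarrow> y = 0"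
  shows "\<exists>A. hermitian_matrix A \<and> L = graph_plane A"
proof -
  have sub: "cpair.subspace L" and eq: "\<And>v. v \<in> L \<longleftrightarrow> (\<forall>u\<in>L. sympl u v = 0)"
    using L unfolding lagrangian_def by blast+
  have add: "(x + x', y + y') \<in> L" if "(x, y) \<in> L" "(x', y') \<in> L" for x y x' y'
    using cpair.subspace_add[OF sub that] by simp
  have scale: "(c *s x, c *s y) \<in> L" if "(x, y) \<in> L" for c x y
    using cpair.subspace_scale[OF sub that, of c] by (simp add: scale2_def)
  have unique: "y = y'" if "(x, y) \<in> L" "(x, y') \<in> L" for x y y'
    using cpair.subspace_diff[OF sub that] transversal[of "y - y'"] by simp
  have "vec.subspace (fst ` L)"
    unfolding vec.subspace_def
  proof (intro conjI ballI allI)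
    show "0 \<in> fst ` L"
      using cpair.subspace_0[OF sub] by (metis fst_zero image_eqI)
    show "x + y \<in> fst ` L" if "x \<in> fst ` L" "y \<in> fst ` L" for x y
      using that add by (force simp: image_iff)
    show "c *s x \<in> fst ` L" if "x \<in> fst ` L" for c x
      using that scale by (force simp: image_iff)
  qed
  moreover have "z = 0" if z: "\<And>x. x \<in> fst ` L \<Longrightarrow> cinner x z = 0" for z
  proof (rule transversal)
    \<comment> \<open>Pairing \<open>(0, z)\<close> with a point \<open>(x, y)\<close> of
      \<open>L\<close> gives \<open>cinner x z\<close>, which is 0; so \<open>(0, z)\<close> lies in
      the symplectic complement of \<open>L\<close>, that is, in \<open>L\<close>.\<close>
    show "(0, z) \<in> L"
      unfolding eq by (auto simp: sympl_def z image_iff) (metis fst_conv image_eqI z)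
  qed
  ultimately have "fst ` L = UNIV"
    by (rule vec_subspace_eq_UNIV_if_cinner)
  have "\<exists>y. (x, y) \<in> L" for x
  proof -
    have "x \<in> fst ` L"
      by (simp add: \<open>fst ` L = UNIV\<close>)
    then show ?thesis
      by force
  qed
  then obtain f where f: "\<And>x. (x, f x) \<in> L"
    using choice[of "\<lambda>x y. (x, y) \<in> L"] by blast
  have "Vector_Spaces.linear (*s) (*s) f"
    unfolding Vector_Spaces.linear_iff using unique[OF f add[OF f f]] unique[OF f scale[OF f]]
    by (simp add: vec.vector_space_axioms)
  then have matrix_f: "matrix f *v x = f x" for x
    by (rule matrix_works)
  have "hermitian_matrix (matrix f)"
    unfolding hermitian_matrix_def
  proof (intro allI)
    fix i j :: 'n
    \<comment> \<open>Isotropy at the points of \<open>L\<close> over two basis vectors compares the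
      entry at \<open>i\<close>, \<open>j\<close> with the one at \<open>j\<close>,
      \<open>i\<close>.\<close>
    have "sympl (axis j 1, f (axis j 1)) (axis i 1, f (axis i 1)) = 0"
      using f eq by blast
    then have "cinner (axis j 1) (f (axis i 1)) = cinner (f (axis j 1)) (axis i 1)"
      by (simp add: sympl_def)
    then show "matrix f $ i $ j = cnj (matrix f $ j $ i)"
      by (simp add: cinner_axis matrix_def)
  qed
  moreover have "L = graph_plane (matrix f)"
    unfolding graph_plane_def matrix_f using f unique by auto
  ultimately show ?thesis
    by blast
qed

text \<open>Eigenvectors of a Lagrangian relation for different real eigenvalues are orthogonal.\<close>

lemma finite_lagrangian_eigenvalues:
  fixes L :: "'n::finite cpair set"
  assumes "lagrangian L"
  shows "finite {t :: real. \<exists>x. x \<noteq> 0 \<and> (x, complex_of_real t *s x) \<in> L}" (is "finite ?R")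
proof -
  obtain f where f: "\<forall>t\<in>?R. f t \<noteq> 0 \<and> (f t, complex_of_real t *s f t) \<in> L"
    using bchoice[of ?R "\<lambda>t x. x \<noteq> 0 \<and> (x, complex_of_real t *s x) \<in> L"] by blast
  have "cinner (f t) (f s) = 0" if "t \<in> ?R" "s \<in> ?R" "t \<noteq> s" for t s
  proof -
    have "sympl (f t, complex_of_real t *s f t) (f s, complex_of_real s *s f s) = 0"
      using f that assms unfolding lagrangian_def by blast
    then show ?thesis
      using \<open>t \<noteq> s\<close> by (simp add: sympl_def cinner_left cinner_right)
  qed
  then show ?thesis
    using f by (intro finite_if_pairwise_cinner[of _ f]) blast+
qed

text \<open>A shear followed by a quarter turn. It sends \<open>(x, t x)\<close> to
  \<open>(0, - x)\<close>, so a plane transversal to the graph of slope \<open>t\<close> becomes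
  transversal to the infinity plane.\<close>

lemma symplectic_rotation:
  fixes t :: real
  defines "S \<equiv> \<lambda>u :: 'n::finite cpair. (snd u - complex_of_real t *s fst u, - fst u)"
  shows "symplectic S"
proof -
  have "Vector_Spaces.linear scale2 scale2 S"
    unfolding Vector_Spaces.linear_iff
    by (simp add: cpair.vector_space_axioms S_def scale2_def vec.scale_right_distrib
        vec.scale_right_diff_distrib mult.commute)
  moreover have "bij S"
    by (rule o_bij[of "\<lambda>v. (- snd v, fst v - complex_of_real t *s snd v)"])
      (simp_all add: S_def fun_eq_iff)
  moreover have "sympl (S u) (S v) = sympl u v" for u v
    by (simp add: S_def sympl_def cinner_left cinner_right cinner_minus cinner_diff)
  ultimately show ?thesis
    unfolding symplectic_def by blast
qed

proposition simultaneous_graph_planes: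
  fixes \<L> :: "'n::finite cpair set set"
  assumes "finite \<L>" and lag: "\<And>L. L \<in> \<L> \<Longrightarrow> lagrangian L"
  shows "\<exists>S. symplectic S \<and> (\<forall>L\<in>\<L>. \<exists>A. hermitian_matrix A \<and> S ` L = graph_plane A)"
proof -
  have "finite (\<Union>L\<in>\<L>. {t :: real. \<exists>x. x \<noteq> 0 \<and> (x, complex_of_real t *s x) \<in> L})"
    using assms finite_lagrangian_eigenvalues by blast
  \<comment> \<open>Each plane excludes only finitely many slopes, so one real slope is admissible
    for all planes of the finite family.\<close>
  from ex_new_if_finite[OF infinite_UNIV_char_0 this]
  obtain t :: real where "t \<notin> (\<Union>L\<in>\<L>. {t. \<exists>x. x \<noteq> 0 \<and> (x, complex_of_real t *s x) \<in> L})" ..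
  then have t: "x = 0" if "L \<in> \<L>" "(x, complex_of_real t *s x) \<in> L" for L x
    using that by blast
  define S where "S = (\<lambda>u :: 'n cpair. (snd u - complex_of_real t *s fst u, - fst u))"
  have S: "symplectic S"
    unfolding S_def by (rule symplectic_rotation)
  have "\<exists>A. hermitian_matrix A \<and> S ` L = graph_plane A" if "L \<in> \<L>" for L
  proof (rule lagrangian_graph_plane)
    show "lagrangian (S ` L)"
      using S lag[OF that] by (rule lagrangian_image)
    \<comment> \<open>A point \<open>(0, y)\<close> of the image comes from
      \<open>(- y, - t y)\<close> in \<open>L\<close>, which the choice of \<open>t\<close> forces
      to be zero.\<close>
    show "y = 0" if "(0, y) \<in> S ` L" for y
      using that t[OF \<open>L \<in> \<L>\<close>] by (auto simp: S_def)
  qed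
  with S show ?thesis
    by blast
qed

section \<open>Range and cocycle identity for arbitrary Lagrangian planes\<close>

text \<open>After reduction to graphs, the lower bound is subadditivity for
  \<open>A3 - A1 = (A2 - A1) + (A3 - A2)\<close>. The upper bound is subadditivity for
  \<open>A3 - A2 = (A3 - A1) + (A1 - A2)\<close>, combined with the fact that the indices of a
  matrix and its negative add up to at most the dimension.\<close>

proposition iota_range:
  fixes L1 L2 L3 :: "'n::finite cpair set"
  assumes lag: "lagrangian L1" "lagrangian L2" "lagrangian L3"
  shows "iota L1 L2 L3 \<in> {0..int CARD('n)}"
proof -
  have "\<exists>S. symplectic S \<and> (\<forall>L\<in>{L1, L2, L3}. \<exists>A. hermitian_matrix A \<and> S ` L = graph_plane A)"
    by (rule simultaneous_graph_planes) (use lag in auto)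
  then obtain S A1 A2 A3 where S: "symplectic S"
    and herm: "hermitian_matrix A1" "hermitian_matrix A2" "hermitian_matrix A3"
    and graphs: "S ` L1 = graph_plane A1" "S ` L2 = graph_plane A2" "S ` L3 = graph_plane A3"
    by auto
  note diff = hermitian_matrix_diff
  have "iota L1 L2 L3 = iota (graph_plane A1) (graph_plane A2) (graph_plane A3)"
    using iota_symplectic_image[OF S, of L1 L2 L3] lag by (simp add: lagrangian_def graphs)
  also have "\<dots> = int (n_minus_matrix (A2 - A1)) + int (n_minus_matrix (A3 - A2)) - int (n_minus_matrix (A3 - A1))"
    by (rule iota_graph_planes[OF herm])
  finally have iota: "iota L1 L2 L3 = \<dots>" .
  have "n_minus_matrix (A3 - A1) \<le> n_minus_matrix (A2 - A1) + n_minus_matrix (A3 - A2)"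
    using n_minus_matrix_add[of "A2 - A1" "A3 - A2"] by (simp add: diff herm)
  moreover have "n_minus_matrix (A3 - A2) \<le> n_minus_matrix (A3 - A1) + n_minus_matrix (- (A2 - A1))"
    using n_minus_matrix_add[of "A3 - A1" "A1 - A2"] by (simp add: diff herm)
  moreover have "n_minus_matrix (A2 - A1) + n_minus_matrix (- (A2 - A1)) \<le> CARD('n)"
    using n_minus_matrix_minus[OF diff[OF herm(2,1)]] by linarith
  ultimately show ?thesis
    by (simp add: iota)
qed

text \<open>One symplectic map makes all four planes graphs at once. Each of the six indices of
  pairwise differences then occurs twice, with opposite signs.\<close>

proposition iota_cocycle:
  assumes lag: "lagrangian L1" "lagrangian L2" "lagrangian L3" "lagrangian L4"
  shows "iota L1 L2 L3 - iota L1 L2 L4 + iota L1 L3 L4 - iota L2 L3 L4 = 0"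
proof -
  have "\<exists>S. symplectic S \<and> (\<forall>L\<in>{L1, L2, L3, L4}. \<exists>A. hermitian_matrix A \<and> S ` L = graph_plane A)"
    by (rule simultaneous_graph_planes) (use lag in auto)
  then obtain S A1 A2 A3 A4 where S: "symplectic S"
    and herm: "hermitian_matrix A1" "hermitian_matrix A2" "hermitian_matrix A3" "hermitian_matrix A4"
    and graphs: "S ` L1 = graph_plane A1" "S ` L2 = graph_plane A2" "S ` L3 = graph_plane A3" "S ` L4 = graph_plane A4"
    by auto
  have sub: "cpair.subspace L1" "cpair.subspace L2" "cpair.subspace L3" "cpair.subspace L4"
    using lag by (simp_all add: lagrangian_def)
  note inv = iota_symplectic_image[OF S, symmetric]
  show ?thesis
    by (simp add: inv sub graphs iota_graph_planes herm)
qed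

theorem theorem2p1:
  shows "(\<forall>L1 L2 L3 :: 'n::finite cpair set.
            lagrangian L1 \<and> lagrangian L2 \<and> lagrangian L3 \<longrightarrow>
            iota L1 L2 L3 \<in> {0..int CARD('n)})
       \<and> (\<forall>A :: complex ^ 'n ^ 'n. hermitian_matrix A \<longrightarrow>
            iota (graph_plane 0) (graph_plane A) infinity_plane = int (n_minus_matrix A))
       \<and> (\<forall>(S :: 'n cpair \<Rightarrow> 'n cpair) L1 L2 L3.
            symplectic S \<and> lagrangian L1 \<and> lagrangian L2 \<and> lagrangian L3 \<longrightarrow>
            iota (S ` L1) (S ` L2) (S ` L3) = iota L1 L2 L3)
       \<and> (\<forall>L1 L2 L3 L4 :: 'n cpair set.
            lagrangian L1 \<and> lagrangian L2 \<and> lagrangian L3 \<and> lagrangian L4 \<longrightarrow>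
            iota L1 L2 L3 - iota L1 L2 L4 + iota L1 L3 L4 - iota L2 L3 L4 = 0)"
proof (intro conjI allI impI)
  fix S :: "'n cpair \<Rightarrow> 'n cpair" and L1 L2 L3 :: "'n cpair set"
  assume "symplectic S \<and> lagrangian L1 \<and> lagrangian L2 \<and> lagrangian L3"
  then show "iota (S ` L1) (S ` L2) (S ` L3) = iota L1 L2 L3"
    by (intro iota_symplectic_image) (simp_all add: lagrangian_def)
qed (simp_all add: iota_range[simplified] iota_zero_graph_infinity iota_cocycle)

end
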